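(* Let $m,n$ be integers, let $a\in\mathbb{R}_+^m$ and $b\in\mathbb{R}_+^n$ be probability vectors with (strictly) positive entries, and let $K\in\mathbb{R}_+^{m\times n}$ be a matrix with (strictly) positive entries such that $\operatorname{rank}(K)=\min(m,n)\ge 2$. Let $$\delta_1=\frac{a_{\min}}{b_{\max}}\cdot\frac{1-b_{\max}}{\left(\frac{\|K\|_\infty}{\sigma_{\min}(K)}\right)^2-a_{\min}}>0,\qquad \delta_2=\frac{b_{\min}}{a_{\max}}\cdot\frac{1-a_{\max}}{\left(\frac{\|K^{\mathsf T}\|_\infty}{\sigma_{\min}(K)}\right)^2-b_{\min}}>0,$$ where $\sigma_{\min}(K)$ is the smallest positive singular value of $K$, $\|A\|_\infty=\max_{\|x\|_\infty=1}\|Ax\|_\infty$ for a matrix $A$, and the subscripts $\min$, $\max$ denote the smallest and largest entry of the corresponding vector. Then the second largest eigenvalue $\vartheta^2$ of the matrix $M$ defined in the context satisfies $$\vartheta^2\ge\delta_{K,a,b}:=\begin{cases}\delta_1&\text{if }m>n,\\ \delta_2&\text{if }m<n,\\ \max(\delta_1,\delta_2)&\text{if }m=n.\end{cases}$$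
   Context: $\mathbb{R}_+$ denotes the (strictly) positive reals; $x\circ y$ is the componentwise product of vectors and $1/a$, $1/b$ are componentwise reciprocals. The pair $(u^*,v^* )\in\mathbb{R}_+^m\times\mathbb{R}_+^n$ denotes a solution of $u\circ Kv=a$, $v\circ K^{\mathsf T}u=b$, which by a classical theorem of Sinkhorn exists and is unique up to rescaling $(tu^*,t^{-1}v^* )$, $t>0$. Let $$P_*=\operatorname{diag}(u^* )\,K\,\operatorname{diag}(v^* ),\qquad M=\operatorname{diag}\left(\tfrac1a\right)P_*\operatorname{diag}\left(\tfrac1b\right)P_*^{\mathsf T}\in\mathbb{R}^{m\times m}$$ (independent of the choice of solution). $M$ is similar to a positive semidefinite matrix, so its eigenvalues are real and nonnegative; its largest eigenvalue is $1$ (with constant eigenvector). $\vartheta^2\in[0,1)$ denotes the second largest eigenvalue of $M$ (counted with multiplicity). *)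

theory Defs
  imports
    "HOL-Analysis.Analysis"
    "HOL-Computational_Algebra.Polynomial"
    "HOL-Library.Multiset"
begin

definition diag :: "'a::zero ^ 'n \<Rightarrow> 'a ^ 'n ^ 'n" where
  "diag d = (\<chi> i j. if i = j then d $ i else 0)"

definition recip :: "real ^ 'n \<Rightarrow> real ^ 'n" where
  "recip x = (\<chi> i. 1 / x $ i)"

definition pos_vec :: "real ^ 'n \<Rightarrow> bool" where
  "pos_vec x \<longleftrightarrow> (\<forall>i. 0 < x $ i)"

definition prob_vec :: "real ^ 'n \<Rightarrow> bool" where
  "prob_vec x \<longleftrightarrow> (\<forall>i. 0 \<le> x $ i) \<and> (\<Sum>i\<in>UNIV. x $ i) = 1"

definition pos_matrix :: "real ^ 'n ^ 'm \<Rightarrow> bool" where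
  "pos_matrix A \<longleftrightarrow> (\<forall>i j. 0 < A $ i $ j)"

definition vec_min :: "real ^ 'n \<Rightarrow> real" where
  "vec_min x = Min (range (\<lambda>i. x $ i))"

definition vec_max :: "real ^ 'n \<Rightarrow> real" where
  "vec_max x = Max (range (\<lambda>i. x $ i))"

text \<open>Operator norm induced by the maximum norm; the maximum over the unit sphere is written as a
  supremum because the sphere is infinite (by compactness it is attained).\<close>

definition matrix_infnorm :: "real ^ 'n ^ 'm \<Rightarrow> real" where
  "matrix_infnorm A = (SUP x\<in>{x. infnorm x = 1}. infnorm (A *v x))"

definition charpoly :: "'a::comm_ring_1 ^ 'n ^ 'n \<Rightarrow> 'a poly" where
  "charpoly A = det (mat [:0, 1:] - (\<chi> i j. [:A $ i $ j:]))"

text \<open>The real eigenvalues with algebraic multiplicity.  For the matrices considered below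
  (\<open>transpose A ** A\<close>, and matrices similar to a symmetric one) these are all the eigenvalues.\<close>

definition eigenvalues :: "real ^ 'n ^ 'n \<Rightarrow> real multiset" where
  "eigenvalues A = proots (charpoly A)"

text \<open>Meaningful only if there are at least two real eigenvalues, counted with multiplicity.\<close>

definition second_largest_eigenvalue :: "real ^ 'n ^ 'n \<Rightarrow> real" where
  "second_largest_eigenvalue A = rev (sorted_list_of_multiset (eigenvalues A)) ! 1"

definition singular_values :: "real ^ 'n ^ 'm \<Rightarrow> real set" where
  "singular_values A = sqrt ` set_mset (eigenvalues (transpose A ** A))"

text \<open>The smallest \<^emph>\<open>positive\<close> singular value; it is well defined for any nonzero matrix.\<close>

definition sigma_min :: "real ^ 'n ^ 'm \<Rightarrow> real" where
  "sigma_min A = Min {s \<in> singular_values A. 0 < s}"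

text \<open>Multiplication of vectors by \<open>*\<close> is componentwise.\<close>

definition sinkhorn_solution ::
    "real ^ 'n ^ 'm \<Rightarrow> real ^ 'm \<Rightarrow> real ^ 'n \<Rightarrow> real ^ 'm \<Rightarrow> real ^ 'n \<Rightarrow> bool" where
  "sinkhorn_solution K a b u v \<longleftrightarrow>
     pos_vec u \<and> pos_vec v \<and> u * (K *v v) = a \<and> v * (transpose K *v u) = b"

definition scaled_matrix :: "real ^ 'n ^ 'm \<Rightarrow> real ^ 'm \<Rightarrow> real ^ 'n \<Rightarrow> real ^ 'n ^ 'm" where
  "scaled_matrix K u v = diag u ** K ** diag v"

definition sinkhorn_M ::
    "real ^ 'n ^ 'm \<Rightarrow> real ^ 'm \<Rightarrow> real ^ 'n \<Rightarrow> real ^ 'm \<Rightarrow> real ^ 'n \<Rightarrow> real ^ 'm ^ 'm" where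
  "sinkhorn_M K a b u v =
     diag (recip a) ** scaled_matrix K u v ** diag (recip b) ** transpose (scaled_matrix K u v)"

definition delta1 :: "real ^ 'n ^ 'm \<Rightarrow> real ^ 'm \<Rightarrow> real ^ 'n \<Rightarrow> real" where
  "delta1 K a b = vec_min a / vec_max b *
     ((1 - vec_max b) / ((matrix_infnorm K / sigma_min K)\<^sup>2 - vec_min a))"

definition delta2 :: "real ^ 'n ^ 'm \<Rightarrow> real ^ 'm \<Rightarrow> real ^ 'n \<Rightarrow> real" where
  "delta2 K a b = vec_min b / vec_max a *
     ((1 - vec_max a) / ((matrix_infnorm (transpose K) / sigma_min K)\<^sup>2 - vec_min b))"

definition delta :: "real ^ 'n ^ 'm \<Rightarrow> real ^ 'm \<Rightarrow> real ^ 'n \<Rightarrow> real" where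
  "delta K a b =
     (if CARD('m) > CARD('n) then delta1 K a b
      else if CARD('m) < CARD('n) then delta2 K a b
      else max (delta1 K a b) (delta2 K a b))"

end

theory Submission
  imports Defs
begin

text \<open>
  Let \<open>N\<close> have the entries \<open>P\<^sub>*(i,j) / sqrt (a\<^sub>i b\<^sub>j)\<close>.  Then \<open>M\<close> is similar to \<open>N N\<^sup>T\<close>, and with
  \<open>p = sqrt a\<close>, \<open>q = sqrt b\<close> one has \<open>N q = p\<close>, \<open>N\<^sup>T p = q\<close>, \<open>\<bar>N\<bar> \<le> 1\<close>.  By Courant--Fischer a vector
  \<open>x\<close> orthogonal to \<open>q\<close> with \<open>\<bar>N x\<bar>\<^sup>2 \<ge> r \<bar>x\<bar>\<^sup>2\<close>, or \<open>w\<close> orthogonal to \<open>p\<close> with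
  \<open>\<bar>N\<^sup>T w\<bar>\<^sup>2 \<ge> r \<bar>w\<bar>\<^sup>2\<close>, forces \<open>\<vartheta>\<^sup>2 \<ge> r\<close>.

  Suppose that \<open>K\<close> is injective, and let \<open>v\<^sub>j\<close> be the largest entry of \<open>v\<close>.  Since
  \<open>u\<^sub>i = a\<^sub>i / (K v)\<^sub>i\<close> and \<open>(K v)\<^sub>i \<le> \<parallel>K\<parallel>\<^sub>\<infinity> v\<^sub>j\<close>, every \<open>z\<close> satisfies
  \<open>\<bar>N z\<bar>\<^sup>2 \<ge> \<alpha> z\<^sub>j\<^sup>2 / b\<^sub>j\<close> with \<open>\<alpha> = a\<^sub>m\<^sub>i\<^sub>n (\<sigma>\<^sub>m\<^sub>i\<^sub>n / \<parallel>K\<parallel>\<^sub>\<infinity>)\<^sup>2\<close>.  Take \<open>x\<close> to be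
  \<open>sqrt b\<^sub>j\<close> times the projection of the \<open>j\<close>-th unit vector onto the complement of \<open>q\<close>, and
  \<open>z = x + c q\<close>, so that \<open>\<bar>N z\<bar>\<^sup>2 = \<bar>N x\<bar>\<^sup>2 + c\<^sup>2\<close>; optimising over \<open>c\<close> gives
  \<open>\<bar>N x\<bar>\<^sup>2 \<ge> \<delta>\<^sub>1 \<bar>x\<bar>\<^sup>2\<close>.  The bound by \<open>\<delta>\<^sub>2\<close> is the same statement for \<open>K\<^sup>T\<close>.
\<close>

subsection \<open>The spectral theorem for symmetric matrices\<close>

text \<open>The quadratic form \<open>f x \<bullet> x\<close> attains its maximum on the compact
  unit sphere of \<open>S\<close>, and a maximiser is an eigenvector. Allowing an invariant subspace
  \<open>S\<close> makes the argument repeatable on orthogonal complements.\<close>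

lemma self_adjoint_eigenvector:
  fixes f :: "'a::euclidean_space \<Rightarrow> 'a"
  assumes lin: "linear f" and sa: "\<And>x y. f x \<bullet> y = x \<bullet> f y"
    and S: "subspace S" "f ` S \<subseteq> S" "S \<noteq> {0}"
  obtains x c where "x \<in> S" "norm x = 1" "f x = c *\<^sub>R x"
proof -
  interpret linear f by fact
  let ?T = "S \<inter> sphere 0 1"
  obtain y where y: "y \<in> S" "y \<noteq> 0"
    using S subspace_0 by blast
  have "(1 / norm y) *\<^sub>R y \<in> ?T"
    using y S(1) by (auto simp: subspace_scale)
  then have "?T \<noteq> {}" by blast
  moreover have "compact ?T"
    by (intro closed_Int_compact closed_subspace S(1) compact_sphere)
  moreover have "continuous_on ?T (\<lambda>x. f x \<bullet> x)"
    by (intro continuous_on_inner continuous_on_id linear_continuous_on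
        lin[unfolded linear_conv_bounded_linear])
  ultimately have "\<exists>x\<in>?T. \<forall>z\<in>?T. f z \<bullet> z \<le> f x \<bullet> x"
    by (intro continuous_attains_sup)
  then obtain x where x: "x \<in> ?T" and max: "\<And>z. z \<in> ?T \<Longrightarrow> f z \<bullet> z \<le> f x \<bullet> x"
    by (elim bexE) (rule that, auto)
  define c where "c = f x \<bullet> x"
  have xx: "x \<bullet> x = 1" and xS: "x \<in> S"
    using x by (auto simp: norm_eq_1)
  have nonneg: "0 \<le> c * (z \<bullet> z) - f z \<bullet> z" if "z \<in> S" for z
  proof (cases "z = 0")
    case False
    have "(1 / norm z) *\<^sub>R z \<in> ?T"
      using False that S(1) by (auto simp: subspace_scale)
    from max[OF this] have "(f z \<bullet> z) / (norm z)\<^sup>2 \<le> c"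
      by (simp add: scale c_def power2_eq_square)
    then show ?thesis
      using False by (simp add: dot_square_norm field_simps)
  qed simp
  define r where "r = f x - c *\<^sub>R x"
  have rS: "r \<in> S"
    using xS S by (auto simp: r_def subspace_diff subspace_scale)
  define G where "G = c * (r \<bullet> r) - f r \<bullet> r"
  have G: "0 \<le> G" using nonneg[OF rS] by (simp add: G_def)
  have fx: "f x = c *\<^sub>R x + r" by (simp add: r_def)
  \<comment> \<open>The quadratic form in \<open>nonneg\<close> vanishes at \<open>x\<close>, so its derivative there in direction \<open>r\<close>,
    which is \<open>- 2 (r \<bullet> r)\<close>, vanishes too.\<close>
  have expand: "0 \<le> t * (t * G - 2 * (r \<bullet> r))" for t
  proof -
    have "0 \<le> c * ((x + t *\<^sub>R r) \<bullet> (x + t *\<^sub>R r)) - f (x + t *\<^sub>R r) \<bullet> (x + t *\<^sub>R r)"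
      using xS rS S(1) by (intro nonneg) (auto simp: subspace_add subspace_scale)
    also have "\<dots> = t * (t * G - 2 * (r \<bullet> r))"
    proof -
      have "f r \<bullet> x = c * (r \<bullet> x) + r \<bullet> r"
        using sa[of r x] fx by (simp add: inner_right_distrib)
      moreover have "r \<bullet> x = 0"
        using xx by (simp add: r_def inner_diff_left c_def)
      ultimately show ?thesis
        using xx by (simp add: add scale inner_left_distrib inner_right_distrib G_def fx
            inner_commute[of x r] algebra_simps)
    qed
    finally show ?thesis .
  qed
  have "r \<bullet> r = 0"
  proof (rule ccontr)
    assume "r \<bullet> r \<noteq> 0"
    then have R: "0 < r \<bullet> r" using inner_ge_zero[of r] by linarith
    \<comment> \<open>For this \<open>t\<close> the product \<open>t * G\<close> is at most
      \<open>r \<bullet> r\<close>, which contradicts \<open>expand\<close>; the \<open>+ 1\<close>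
      covers \<open>G = 0\<close>.\<close>
    have "0 \<le> (r \<bullet> r) / (G + 1) * G - 2 * (r \<bullet> r)"
      using expand[of "(r \<bullet> r) / (G + 1)"] R G
      by (metis add_strict_increasing2 divide_pos_pos linorder_not_less mult_pos_neg zero_less_one)
    moreover have "(r \<bullet> r) / (G + 1) * G \<le> r \<bullet> r"
      using R G by (simp add: divide_simps mult_left_le)
    ultimately show False using R by linarith
  qed
  then show ?thesis
    using that[of x c] x fx by simp
qed

lemma symmetric_matrix_self_adjoint:
  fixes A :: "real ^ 'n ^ 'n"
  assumes "transpose A = A"
  shows "(A *v x) \<bullet> y = x \<bullet> (A *v y)"
  by (metis assms dot_lmul_matrix transpose_matrix_vector)

text \<open>Since \<open>A\<close> is self-adjoint, the orthogonal complement of the eigenvectors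
  found so far is invariant, and it is nonzero as long as fewer than \<open>CARD('n)\<close> have
  been found.\<close>

lemma orthonormal_eigenvectors:
  fixes A :: "real ^ 'n ^ 'n"
  assumes sym: "transpose A = A" and "k \<le> CARD('n)"
  shows "\<exists>B. finite B \<and> card B = k \<and> pairwise orthogonal B \<and>
    (\<forall>x\<in>B. norm x = 1 \<and> (\<exists>c. A *v x = c *\<^sub>R x))"
  using assms(2)
proof (induction k)
  case 0
  show ?case by (intro exI[of _ "{}"]) simp
next
  case (Suc k)
  then obtain B where B: "finite B" "card B = k" "pairwise orthogonal B"
    and eig: "\<And>x. x \<in> B \<Longrightarrow> norm x = 1" "\<And>x. x \<in> B \<Longrightarrow> \<exists>c. A *v x = c *\<^sub>R x"
    by auto
  let ?S = "{y. \<forall>x\<in>B. orthogonal x y}"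
  have "dim B \<le> k"
    using B dim_le_card' by blast
  then have "dim (span B) < DIM(real ^ 'n)"
    using Suc.prems by (simp add: dim_span)
  then have "span B \<subset> UNIV"
    by (metis dim_UNIV less_irrefl top.not_eq_extremum)
  then obtain y where "y \<noteq> 0" "\<And>x. x \<in> span B \<Longrightarrow> orthogonal y x"
    using orthogonal_to_subspace_exists_gen[of B UNIV] by (metis dim_UNIV dim_span span_UNIV)
  then have "y \<in> ?S" by (auto simp: span_base orthogonal_commute)
  then have S0: "?S \<noteq> {0}" using \<open>y \<noteq> 0\<close> by blast
  have Ssub: "subspace ?S" by (auto simp: subspace_def orthogonal_clauses)
  have Sinv: "(*v) A ` ?S \<subseteq> ?S"
  proof clarify
    fix y x assume y: "\<forall>x\<in>B. orthogonal x y" and x: "x \<in> B"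
    obtain c where "A *v x = c *\<^sub>R x" using eig(2) x by blast
    then have "x \<bullet> (A *v y) = c * (x \<bullet> y)"
      using symmetric_matrix_self_adjoint[OF sym, of x y] by simp
    then show "orthogonal x (A *v y)"
      using y x by (simp add: orthogonal_def)
  qed
  obtain x c where x: "x \<in> ?S" "norm x = 1" "A *v x = c *\<^sub>R x"
    using self_adjoint_eigenvector[of "(*v) A", OF _ symmetric_matrix_self_adjoint[OF sym] Ssub Sinv S0]
    by auto
  have "x \<notin> B"
    using x by (auto simp: orthogonal_def)
  then have "card (insert x B) = Suc k" using B by simp
  moreover have "pairwise orthogonal (insert x B)"
    using B(3) x(1) by (auto simp: pairwise_insert orthogonal_commute)
  ultimately show ?case
    using B(1) x eig by (intro exI[of _ "insert x B"]) auto
qed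

section \<open>Characteristic polynomials and diagonalisation\<close>

definition const_matrix :: "'a::comm_ring_1 ^ 'n ^ 'm \<Rightarrow> 'a poly ^ 'n ^ 'm" where
  "const_matrix A = (\<chi> i j. [:A $ i $ j:])"

lemma const_matrix_mult: "const_matrix (A ** B) = const_matrix A ** const_matrix B"
  by (simp add: const_matrix_def matrix_matrix_mult_def vec_eq_iff mult.commute[of "B $ _ $ _"]
      flip: sum_to_poly)

lemma det_const_matrix: "det (const_matrix A) = [:det A:]"
  by (simp add: det_def const_matrix_def prod_to_poly of_int_poly
      mult.commute[of "of_int _"] flip: sum_to_poly)

lemma matrix_diff_ldistrib: "A ** (B - C) = A ** B - A ** C"
  for A :: "'a::comm_ring_1 ^ 'n ^ 'm" and B C :: "'a ^ 'k ^ 'n"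
  by (simp add: vec_eq_iff matrix_matrix_mult_def right_diff_distrib sum_subtractf)

lemma matrix_diff_rdistrib: "(B - C) ** A = B ** A - C ** A"
  for A :: "'a::comm_ring_1 ^ 'n ^ 'm" and B C :: "'a ^ 'm ^ 'k"
  by (simp add: vec_eq_iff matrix_matrix_mult_def left_diff_distrib sum_subtractf)

lemma mat_commute:
  fixes X :: "'a::comm_semiring_1 ^ 'n ^ 'n"
  shows "mat c ** X = X ** mat c"
  by (simp add: matrix_matrix_mult_def mat_def vec_eq_iff if_distrib if_distribR
      mult.commute cong: if_cong)

text \<open>Over the polynomial ring \<open>S\<close> still intertwines X - A and X - B; taking
  determinants leaves the nonzero constant \<open>det S\<close> to cancel, so no inverse of
  \<open>S\<close> is formed.\<close>

lemma charpoly_eqI: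
  fixes A B :: "'a::idom ^ 'n ^ 'n"
  assumes "A ** S = S ** B" "det S \<noteq> 0"
  shows "charpoly A = charpoly B"
proof -
  have "(mat [:0, 1:] - const_matrix A) ** const_matrix S
      = const_matrix S ** (mat [:0, 1:] - const_matrix B)"
    using assms(1)
    by (simp add: matrix_diff_rdistrib matrix_diff_ldistrib const_matrix_mult[symmetric] mat_commute)
  then have "[:det S:] * det (mat [:0, 1:] - const_matrix A)
      = [:det S:] * det (mat [:0, 1:] - const_matrix B)"
    by (metis det_mul det_const_matrix mult.commute)
  then have "det (mat [:0, 1:] - const_matrix A) = det (mat [:0, 1:] - const_matrix B)"
    using assms(2) mult_left_cancel by (metis pCons_eq_0_iff)
  then show ?thesis
    by (simp add: charpoly_def const_matrix_def)
qed

lemma charpoly_diag: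
  fixes d :: "'a::comm_ring_1 ^ 'n"
  shows "charpoly (diag d) = (\<Prod>i\<in>UNIV. [:- (d $ i), 1:])"
  unfolding charpoly_def
  by (subst det_diagonal) (auto simp: diag_def mat_def)

text \<open>With orthonormal eigenvectors as the columns of \<open>Q\<close>, \<open>A\<close> is
  similar to \<open>diag d\<close>, whose characteristic polynomial splits into linear factors; this
  counts eigenvalues with multiplicity.\<close>

lemma spectral_theorem:
  fixes A :: "real ^ 'n ^ 'n"
  assumes sym: "transpose A = A"
  obtains Q d where "orthogonal_matrix Q" "A ** Q = Q ** diag d"
    "eigenvalues A = image_mset (($) d) (mset_set UNIV)"
proof -
  obtain B where B: "finite B" "card B = CARD('n)" "pairwise orthogonal B"
    and eig: "\<And>x. x \<in> B \<Longrightarrow> norm x = 1 \<and> (\<exists>c. A *v x = c *\<^sub>R x)"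
    using orthonormal_eigenvectors[OF sym order_refl] by blast
  obtain q :: "'n \<Rightarrow> real ^ 'n" where q: "bij_betw q UNIV B"
    using B by (metis bij_betw_iff_card finite_class.finite_UNIV)
  then have qB: "q i \<in> B" for i by (auto simp: bij_betw_def)
  obtain e where e: "\<And>i. A *v q i = e i *\<^sub>R q i"
    using eig[OF qB] by metis
  define d :: "real ^ 'n" where "d = (\<chi> i. e i)"
  define Q where "Q = transpose (\<chi> i. q i)"
  have "q i \<bullet> q j = (if i = j then 1 else 0)" for i j
    using eig[OF qB, of i] B(3) qB[of i] qB[of j] q
    by (auto simp: norm_eq_1 pairwise_def orthogonal_def bij_betw_def inj_on_def)
  then have orth: "orthogonal_matrix Q"
    by (simp add: orthogonal_matrix Q_def transpose_def matrix_matrix_mult_def mat_def vec_eq_iff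
        inner_vec_def)
  have "(A ** Q) $ i $ j = (Q ** diag d) $ i $ j" for i j
    using arg_cong[OF e[of j], of "\<lambda>x. x $ i"]
    by (simp add: matrix_matrix_mult_def matrix_vector_mult_def Q_def transpose_def d_def diag_def
        if_distrib mult.commute cong: if_cong)
  then have AQ: "A ** Q = Q ** diag d" by (simp add: vec_eq_iff)
  have "det Q \<noteq> 0"
    using det_orthogonal_matrix[OF orth] by auto
  then have cp: "charpoly A = (\<Prod>i\<in>UNIV. [:- (d $ i), 1:])"
    using charpoly_eqI[OF AQ] by (simp add: charpoly_diag)
  have "eigenvalues A = (\<Sum>i\<in>UNIV. {#d $ i#})"
    unfolding eigenvalues_def cp by (subst proots_prod) auto
  also have "\<dots> = image_mset (($) d) (mset_set UNIV)"
    by (simp add: sum_unfold_sum_mset)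
  finally show ?thesis using that orth AQ by blast
qed

lemma spectral_expansion:
  fixes A Q :: "real ^ 'n ^ 'n"
  assumes "orthogonal_matrix Q" "A ** Q = Q ** diag d"
  shows "x \<bullet> x = (\<Sum>i\<in>UNIV. ((transpose Q *v x) $ i)\<^sup>2)"
    and "x \<bullet> (A *v x) = (\<Sum>i\<in>UNIV. d $ i * ((transpose Q *v x) $ i)\<^sup>2)"
proof -
  define y where "y = transpose Q *v x"
  have x: "x = Q *v y"
    using assms(1) unfolding y_def orthogonal_matrix_def
    by (metis matrix_vector_mul_assoc matrix_vector_mul_lid)
  have inner: "(Q *v y) \<bullet> (Q *v z) = y \<bullet> z" for y z
    using assms(1) 
    by (metis orthogonal_matrix_def dot_lmul_matrix matrix_vector_mul_assoc matrix_vector_mul_lid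
        transpose_matrix_vector transpose_transpose)
  show "x \<bullet> x = (\<Sum>i\<in>UNIV. ((transpose Q *v x) $ i)\<^sup>2)"
    unfolding y_def[symmetric] unfolding x inner by (simp add: inner_vec_def power2_eq_square)
  have "A *v x = Q *v (diag d *v y)"
    by (simp add: x matrix_vector_mul_assoc assms(2))
  then have "x \<bullet> (A *v x) = y \<bullet> (diag d *v y)"
    using x inner by metis
  also have "\<dots> = (\<Sum>i\<in>UNIV. d $ i * (y $ i)\<^sup>2)"
    by (simp add: inner_vec_def diag_def matrix_vector_mult_def if_distrib if_distribR
        power2_eq_square algebra_simps cong: if_cong)
  finally show "x \<bullet> (A *v x) = (\<Sum>i\<in>UNIV. d $ i * ((transpose Q *v x) $ i)\<^sup>2)"
    by (simp add: y_def)
qed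

text \<open>In the coordinates \<open>transpose Q *v x\<close> the matrix acts as
  \<open>diag d\<close>, so a nonzero coordinate of an eigenvector singles out an entry of
  \<open>d\<close> equal to its eigenvalue.\<close>

lemma mem_eigenvalues_symmetric_iff:
  fixes A :: "real ^ 'n ^ 'n"
  assumes sym: "transpose A = A"
  shows "c \<in># eigenvalues A \<longleftrightarrow> (\<exists>x. x \<noteq> 0 \<and> A *v x = c *\<^sub>R x)"
proof -
  obtain Q d where Q: "orthogonal_matrix Q" "A ** Q = Q ** diag d"
    and ev: "eigenvalues A = image_mset (($) d) (mset_set UNIV)"
    using spectral_theorem[OF sym] by blast
  have QQ: "transpose Q *v (Q *v x) = x" "Q *v (transpose Q *v x) = x" for x
    using Q(1) unfolding orthogonal_matrix_def
    by (metis matrix_vector_mul_assoc matrix_vector_mul_lid)+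
  have AQ: "A *v (Q *v x) = Q *v (diag d *v x)" for x
    by (simp add: matrix_vector_mul_assoc Q(2))
  have diag: "(diag d *v x) $ i = d $ i * x $ i" for x i
    by (simp add: diag_def matrix_vector_mult_def if_distrib if_distribR cong: if_cong)
  show ?thesis
  proof
    assume "c \<in># eigenvalues A"
    then obtain i where i: "c = d $ i" by (auto simp: ev)
    have "diag d *v axis i 1 = c *\<^sub>R axis i 1"
      by (simp add: vec_eq_iff diag i axis_def)
    then have "A *v (Q *v axis i 1) = c *\<^sub>R (Q *v axis i 1)"
      by (simp add: AQ matrix_vector_mult_scaleR)
    moreover have "Q *v axis i 1 \<noteq> 0"
      using QQ(1)[of "axis i 1"] by (auto simp: axis_eq_0_iff)
    ultimately show "\<exists>x. x \<noteq> 0 \<and> A *v x = c *\<^sub>R x" by blast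
  next
    assume "\<exists>x. x \<noteq> 0 \<and> A *v x = c *\<^sub>R x"
    then obtain x where x: "x \<noteq> 0" "A *v x = c *\<^sub>R x" by blast
    define y where "y = transpose Q *v x"
    have Qy: "Q *v y = x" by (simp only: y_def QQ)
    have "Q *v (diag d *v y) = Q *v (c *\<^sub>R y)"
      by (simp add: AQ[symmetric] Qy x(2) matrix_vector_mult_scaleR)
    then have "diag d *v y = c *\<^sub>R y" by (metis QQ(1))
    moreover have "y \<noteq> 0" using Qy x(1) by auto
    then obtain i where "y $ i \<noteq> 0" by (auto simp: vec_eq_iff)
    ultimately have "c = d $ i" using diag[of y i] by simp
    then show "c \<in># eigenvalues A" by (simp add: ev)
  qed
qed

subsection \<open>Singular values\<close>

lemma transpose_mult_self: "transpose (transpose A ** A) = transpose A ** A"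
  for A :: "'a::comm_semiring_1 ^ 'n ^ 'm"
  by (simp add: matrix_transpose_mul)

lemma inner_transpose_mult:
  fixes A :: "real ^ 'n ^ 'm"
  shows "x \<bullet> (transpose A *v y) = (A *v x) \<bullet> y"
  by (metis dot_lmul_matrix inner_commute transpose_matrix_vector)

lemma pos_singular_values_iff:
  fixes A :: "real ^ 'n ^ 'm"
  assumes "0 < s"
  shows "s \<in> singular_values A \<longleftrightarrow> (\<exists>x. x \<noteq> 0 \<and> transpose A *v (A *v x) = s\<^sup>2 *\<^sub>R x)"
proof -
  have "s \<in> singular_values A \<longleftrightarrow> s\<^sup>2 \<in># eigenvalues (transpose A ** A)"
    using assms unfolding singular_values_def
    by (smt (verit) image_iff real_sqrt_abs real_sqrt_eq_iff real_sqrt_pow2 real_sqrt_gt_0_iff)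
  then show ?thesis
    by (simp add: mem_eigenvalues_symmetric_iff[OF transpose_mult_self] matrix_vector_mul_assoc)
qed

text \<open>If \<open>x\<close> is an eigenvector of A^T A for s^2 > 0, then \<open>A *v x\<close>
  is nonzero and an eigenvector of A A^T for s^2.\<close>

lemma pos_singular_values_transpose_imp:
  fixes A :: "real ^ 'n ^ 'm"
  assumes "0 < s" "s \<in> singular_values A"
  shows "s \<in> singular_values (transpose A)"
proof -
  obtain x where x: "x \<noteq> 0" "transpose A *v (A *v x) = s\<^sup>2 *\<^sub>R x"
    using assms pos_singular_values_iff by blast
  have "A *v x \<noteq> 0"
    using x assms(1) by (metis matrix_vector_mult_0_right scaleR_eq_0_iff zero_eq_power2 less_irrefl)
  moreover have "A *v (transpose A *v (A *v x)) = s\<^sup>2 *\<^sub>R (A *v x)"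
    by (simp only: x(2) matrix_vector_mult_scaleR)
  ultimately show ?thesis
    using pos_singular_values_iff[OF assms(1), of "transpose A"] by (metis transpose_transpose)
qed

lemma sigma_min_transpose: "sigma_min (transpose A) = sigma_min A"
proof -
  have "{s \<in> singular_values (transpose A). 0 < s} = {s \<in> singular_values A. 0 < s}"
    using pos_singular_values_transpose_imp[of _ A]
      pos_singular_values_transpose_imp[of _ "transpose A"]
    by auto
  then show ?thesis by (simp add: sigma_min_def)
qed

text \<open>For injective \<open>A\<close> the matrix A^T A is positive definite, so the smallest
  positive singular value is the smallest of all and bounds the Rayleigh quotient from
  below.\<close>

lemma injective_sigma_min:
  fixes A :: "real ^ 'n ^ 'm"
  assumes inj: "inj ((*v) A)"
  shows "0 < sigma_min A" and "(sigma_min A)\<^sup>2 * (x \<bullet> x) \<le> (A *v x) \<bullet> (A *v x)"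
proof -
  let ?S = "{s \<in> singular_values A. 0 < s}"
  obtain Q d where Q: "orthogonal_matrix Q" "(transpose A ** A) ** Q = Q ** diag d"
    and ev: "eigenvalues (transpose A ** A) = image_mset (($) d) (mset_set UNIV)"
    using spectral_theorem[OF transpose_mult_self] by blast
  have quad: "x \<bullet> ((transpose A ** A) *v x) = (A *v x) \<bullet> (A *v x)" for x
    by (metis inner_transpose_mult matrix_vector_mul_assoc)
  have dpos: "0 < d $ i" for i
  proof -
    have "d $ i \<in># eigenvalues (transpose A ** A)" by (simp add: ev)
    then obtain x where x: "x \<noteq> 0" "(transpose A ** A) *v x = d $ i *\<^sub>R x"
      using mem_eigenvalues_symmetric_iff[OF transpose_mult_self] by blast
    have "A *v x \<noteq> 0"
      using inj x(1) by (metis injD matrix_vector_mult_0_right)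
    then have "0 < d $ i * (x \<bullet> x)"
      using quad[of x] by (simp add: x(2))
    then show ?thesis
      by (metis inner_ge_zero mult_nonpos_nonneg not_less)
  qed
  then have sqrt_mem: "sqrt (d $ i) \<in> ?S" for i
    by (auto simp: singular_values_def ev)
  have fin: "finite ?S" by (simp add: singular_values_def)
  have "sigma_min A \<in> ?S"
    unfolding sigma_min_def using sqrt_mem by (intro Min_in fin) blast
  then show pos: "0 < sigma_min A" by simp
  have le: "(sigma_min A)\<^sup>2 \<le> d $ i" for i
  proof -
    have "sigma_min A \<le> sqrt (d $ i)"
      unfolding sigma_min_def using fin sqrt_mem by (intro Min_le)
    then show ?thesis
      using pos dpos[of i] by (metis less_imp_le power_mono real_sqrt_pow2)
  qed
  show "(sigma_min A)\<^sup>2 * (x \<bullet> x) \<le> (A *v x) \<bullet> (A *v x)"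
    unfolding quad[symmetric] spectral_expansion[OF Q] sum_distrib_left
    by (intro sum_mono mult_right_mono le) simp
qed

subsection \<open>The second largest eigenvalue\<close>

text \<open>Distinct indices \<open>i\<close>, \<open>j\<close> contribute two members of the
  multiset even if \<open>f i = f j\<close>. If position 1 of the descending list were below
  \<open>r\<close>, only its head could reach \<open>r\<close>.\<close>

lemma second_largest_eigenvalue_ge:
  fixes A :: "real ^ 'n ^ 'n"
  assumes ev: "eigenvalues A = image_mset f (mset_set (UNIV :: 'k::finite set))"
    and ij: "i \<noteq> j" "r \<le> f i" "r \<le> f j"
  shows "r \<le> second_largest_eigenvalue A"
proof -
  define xs where "xs = rev (sorted_list_of_multiset (eigenvalues A))"
  have "mset_set {i, j} \<subseteq># mset_set (UNIV :: 'k set)"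
    by (intro subset_imp_msubset_mset_set) auto
  then have "image_mset f (mset_set {i, j}) \<subseteq># mset xs"
    by (simp add: xs_def ev image_mset_subseteq_mono)
  then have "filter_mset ((\<le>) r) {#f i, f j#} \<subseteq># filter_mset ((\<le>) r) (mset xs)"
    using ij(1) by (intro multiset_filter_mono) simp
  then have len: "2 \<le> length (filter ((\<le>) r) xs)"
    using ij by (auto dest!: size_mset_mono simp flip: mset_filter)
  moreover have "length (filter ((\<le>) r) xs) \<le> length xs" by simp
  ultimately have "2 \<le> length xs" by linarith
  then obtain y z zs where xs: "xs = y # z # zs"
    by (cases xs; cases "tl xs") auto
  have "sorted_wrt (\<ge>) xs"
    by (simp add: xs_def sorted_wrt_rev)
  then have le: "\<forall>w\<in>set zs. w \<le> z" by (simp add: xs)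
  have "r \<le> z"
  proof (rule ccontr)
    assume "\<not> r \<le> z"
    then have "filter ((\<le>) r) zs = []" using le by (auto simp: filter_empty_conv)
    then show False using len \<open>\<not> r \<le> z\<close> by (simp add: xs split: if_splits)
  qed
  then show ?thesis
    by (simp add: second_largest_eigenvalue_def xs_def[symmetric] xs)
qed

text \<open>The quotient at \<open>p\<close> is 1, hence at least \<open>r\<close>, and
  orthogonality kills the cross terms, so the bound at \<open>w\<close> extends to the whole plane
  spanned by \<open>p\<close> and \<open>w\<close>.\<close>

lemma second_largest_eigenvalue_ge_Rayleigh:
  fixes A :: "real ^ 'n ^ 'n"
  assumes sym: "transpose A = A" and p: "A *v p = p" "p \<noteq> 0"
    and w: "w \<noteq> 0" "w \<bullet> p = 0" "r * (w \<bullet> w) \<le> w \<bullet> (A *v w)" and r: "r \<le> 1"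
  shows "r \<le> second_largest_eigenvalue A"
proof -
  obtain Q d where Q: "orthogonal_matrix Q" "A ** Q = Q ** diag d"
    and ev: "eigenvalues A = image_mset (($) d) (mset_set UNIV)"
    using spectral_theorem[OF sym] by blast
  have "\<exists>i j. i \<noteq> j \<and> r \<le> d $ i \<and> r \<le> d $ j"
  proof (rule ccontr)
    \<comment> \<open>The plane spanned by \<open>p\<close> and \<open>w\<close>, on which the Rayleigh quotient is at least \<open>r\<close>, meets the
      hyperplane orthogonal to the only eigenvector with eigenvalue at least \<open>r\<close>.\<close>
    assume "\<not> ?thesis"
    \<comment> \<open>If no entry of \<open>d\<close> reaches \<open>r\<close>, any index serves as
      \<open>k\<close>.\<close>
    then obtain k where k: "\<And>i. i \<noteq> k \<Longrightarrow> d $ i < r" by (metis not_le)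
    let ?c = "\<lambda>x. (transpose Q *v x) $ k"
    obtain s t where st: "s * ?c p + t * ?c w = 0" "s \<noteq> 0 \<or> t \<noteq> 0"
    proof (cases "?c p = 0")
      case True
      then show ?thesis using that[of 1 0] by simp
    next
      case False
      then show ?thesis using that[of "- ?c w" "?c p"] by simp
    qed
    define z where "z = s *\<^sub>R p + t *\<^sub>R w"
    have "w \<bullet> (A *v p) = 0" "p \<bullet> (A *v w) = 0"
      using p(1) w(2) symmetric_matrix_self_adjoint[OF sym, of p w] by (auto simp: inner_commute)
    then have zAz: "z \<bullet> (A *v z) = s\<^sup>2 * (p \<bullet> p) + t\<^sup>2 * (w \<bullet> (A *v w))"
      by (simp add: z_def matrix_vector_right_distrib matrix_vector_mult_scaleR p(1)
          inner_left_distrib inner_right_distrib power2_eq_square)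
    have zz: "z \<bullet> z = s\<^sup>2 * (p \<bullet> p) + t\<^sup>2 * (w \<bullet> w)"
      using w(2) by (simp add: z_def inner_left_distrib inner_right_distrib power2_eq_square
          inner_commute[of p w])
    have pos: "0 < p \<bullet> p" "0 < w \<bullet> w" using p(2) w(1) by auto
    then have "0 < z \<bullet> z"
      using st(2) unfolding zz
      by (metis add_nonneg_pos add_pos_nonneg less_imp_le mult_nonneg_nonneg mult_pos_pos
          zero_le_power2 zero_less_power2)
    have "r * (s\<^sup>2 * (p \<bullet> p)) \<le> s\<^sup>2 * (p \<bullet> p)"
      using mult_right_mono[OF r, of "s\<^sup>2 * (p \<bullet> p)"] by simp
    moreover have "t\<^sup>2 * (r * (w \<bullet> w)) \<le> t\<^sup>2 * (w \<bullet> (A *v w))"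
      using w(3) by (intro mult_left_mono) auto
    ultimately have ge: "r * (z \<bullet> z) \<le> z \<bullet> (A *v z)"
      unfolding zAz zz by (simp add: algebra_simps)
    have cz: "?c z = 0"
      using st(1) by (simp add: z_def matrix_vector_right_distrib matrix_vector_mult_scaleR)
    have "\<exists>i. (transpose Q *v z) $ i \<noteq> 0"
    proof (rule ccontr)
      assume "\<not> ?thesis"
      then have "z \<bullet> z = 0" by (simp add: spectral_expansion(1)[OF Q])
      then show False using \<open>0 < z \<bullet> z\<close> by simp
    qed
    then obtain i where i: "(transpose Q *v z) $ i \<noteq> 0" by blast
    have "z \<bullet> (A *v z) < r * (z \<bullet> z)"
      unfolding spectral_expansion[OF Q] sum_distrib_left
    proof (rule sum_strict_mono_ex1)
      show "\<forall>i\<in>UNIV. d $ i * ((transpose Q *v z) $ i)\<^sup>2 \<le> r * ((transpose Q *v z) $ i)\<^sup>2"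
        using k cz by (metis less_imp_le mult_right_mono zero_le_power2
            mult_zero_right zero_eq_power2 order_refl)
      show "\<exists>i\<in>UNIV. d $ i * ((transpose Q *v z) $ i)\<^sup>2 < r * ((transpose Q *v z) $ i)\<^sup>2"
        using k i cz by (metis UNIV_I mult_strict_right_mono zero_less_power2)
    qed simp
    then show False using ge by linarith
  qed
  then show ?thesis
    using second_largest_eigenvalue_ge[OF ev] by blast
qed

subsection \<open>Bounds on entries\<close>

text \<open>A real \<open>SUP\<close> is an upper bound only when the set is bounded above;
  comparison with the Euclidean norm provides this.\<close>

lemma matrix_vector_le_infnorm:
  fixes A :: "real ^ 'n ^ 'm"
  assumes "infnorm x = 1"
  shows "infnorm (A *v x) \<le> matrix_infnorm A"
proof -
  obtain B where B: "\<And>x. norm (A *v x) \<le> norm x * B"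
    using bounded_linear.bounded[OF matrix_vector_mul_bounded_linear[of A]] by blast
  have "infnorm (A *v y) \<le> sqrt CARD('n) * \<bar>B\<bar>" if "infnorm y = 1" for y
  proof -
    have "infnorm (A *v y) \<le> norm y * \<bar>B\<bar>"
      using infnorm_le_norm[of "A *v y"] B[of y]
      by (meson abs_ge_self mult_left_mono norm_ge_zero order_trans)
    also have "norm y \<le> sqrt CARD('n)"
      using norm_le_infnorm[of y] that by simp
    finally show ?thesis by (simp add: mult_right_mono)
  qed
  then have "bdd_above ((\<lambda>x. infnorm (A *v x)) ` {x. infnorm x = 1})"
    by (intro bdd_aboveI2) auto
  then show ?thesis
    unfolding matrix_infnorm_def using assms by (intro cSUP_upper) auto
qed

lemma row_sum_le_matrix_infnorm:
  fixes A :: "real ^ 'n ^ 'm"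
  shows "(\<Sum>j\<in>UNIV. A $ i $ j) \<le> matrix_infnorm A"
proof -
  define e :: "real ^ 'n" where "e = (\<chi> j. 1)"
  have "infnorm e = 1"
    by (simp add: infnorm_cart e_def)
  then have "infnorm (A *v e) \<le> matrix_infnorm A"
    by (rule matrix_vector_le_infnorm)
  then show ?thesis
    using component_le_infnorm_cart[of "A *v e" i]
    by (simp add: matrix_vector_mult_def e_def)
qed

text \<open>With at least two columns a row sum strictly exceeds each of its positive entries; the
  strictness keeps the denominator of \<open>delta1\<close> positive.\<close>

lemma entry_less_matrix_infnorm:
  fixes A :: "real ^ 'n ^ 'm"
  assumes A: "pos_matrix A" and n: "2 \<le> CARD('n)"
  shows "A $ i $ j < matrix_infnorm A"
proof -
  have "\<not> (UNIV :: 'n set) \<subseteq> {j}"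
    using n card_mono[of "{j}" "UNIV :: 'n set"] by auto
  then obtain k where k: "k \<noteq> j" by blast
  have "A $ i $ j < (\<Sum>j\<in>{j, k}. A $ i $ j)"
    using A k by (simp add: pos_matrix_def)
  also have "\<dots> \<le> (\<Sum>j\<in>UNIV. A $ i $ j)"
    using A by (intro sum_mono2) (auto simp: pos_matrix_def less_imp_le)
  finally show ?thesis using row_sum_le_matrix_infnorm[of A i] by linarith
qed

lemma vec_min_le: "vec_min x \<le> x $ i"
  by (simp add: vec_min_def)

lemma vec_max_ge: "x $ i \<le> vec_max x"
  by (simp add: vec_max_def)

lemma vec_min_mem: "\<exists>i. vec_min x = x $ i"
proof -
  have "vec_min x \<in> range (($) x)"
    unfolding vec_min_def by (intro Min_in) auto
  then show ?thesis by blast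
qed

lemma vec_max_mem: "\<exists>i. vec_max x = x $ i"
proof -
  have "vec_max x \<in> range (($) x)"
    unfolding vec_max_def by (intro Max_in) auto
  then show ?thesis by blast
qed

lemma prob_vec_less_1:
  fixes b :: "real ^ 'n"
  assumes b: "pos_vec b" "prob_vec b" and n: "2 \<le> CARD('n)"
  shows "b $ j < 1"
proof -
  have "\<not> (UNIV :: 'n set) \<subseteq> {j}"
    using n card_mono[of "{j}" "UNIV :: 'n set"] by auto
  then obtain k where k: "k \<noteq> j" by blast
  have "b $ j < (\<Sum>j\<in>{j, k}. b $ j)"
    using b k by (simp add: pos_vec_def)
  also have "\<dots> \<le> (\<Sum>j\<in>UNIV. b $ j)"
    using b by (intro sum_mono2) (auto simp: pos_vec_def less_imp_le)
  finally show ?thesis using b by (simp add: prob_vec_def)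
qed

lemma inner_matrix_vector_axis:
  fixes A :: "real ^ 'n ^ 'm"
  shows "(A *v axis j 1) \<bullet> (A *v axis j 1) = (\<Sum>i\<in>UNIV. (A $ i $ j)\<^sup>2)"
  by (simp add: inner_vec_def matrix_vector_mult_basis column_def power2_eq_square)

subsection \<open>Sinkhorn scalings\<close>

definition sqrt_vec :: "real ^ 'n \<Rightarrow> real ^ 'n" where
  "sqrt_vec x = (\<chi> i. sqrt (x $ i))"

definition normalized_matrix ::
    "real ^ 'n ^ 'm \<Rightarrow> real ^ 'm \<Rightarrow> real ^ 'n \<Rightarrow> real ^ 'm \<Rightarrow> real ^ 'n \<Rightarrow> real ^ 'n ^ 'm" where
  "normalized_matrix K a b u v =
     (\<chi> i j. u $ i * K $ i $ j * v $ j / (sqrt (a $ i) * sqrt (b $ j)))"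

lemma transpose_normalized_matrix:
  "transpose (normalized_matrix K a b u v) = normalized_matrix (transpose K) b a v u"
  by (simp add: normalized_matrix_def transpose_def vec_eq_iff mult_ac)

lemma diag_mult_nth: "(diag d ** A) $ i $ j = d $ i * A $ i $ j"
  by (simp add: diag_def matrix_matrix_mult_def if_distrib if_distribR cong: if_cong)

lemma mult_diag_nth: "(A ** diag d) $ i $ j = A $ i $ j * d $ j"
  by (simp add: diag_def matrix_matrix_mult_def if_distrib if_distribR cong: if_cong)

locale sinkhorn_scaling =
  fixes K :: "real ^ 'n ^ 'm"
    and a u :: "real ^ 'm"
    and b v :: "real ^ 'n"
  assumes a: "pos_vec a" "prob_vec a"
    and b: "pos_vec b" "prob_vec b"
    and K: "pos_matrix K"
    and sol: "sinkhorn_solution K a b u v"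
begin

abbreviation "N \<equiv> normalized_matrix K a b u v"

text \<open>The scaling equations are symmetric under exchanging (K, a, u) with (K^T, b, v), so each
  result of the locale has a transposed twin.\<close>

lemma dual: "sinkhorn_scaling (transpose K) b v a u"
  using a b K sol
  by unfold_locales (auto simp: sinkhorn_solution_def pos_matrix_def transpose_def)

lemma pos: "0 < a $ i" "0 < b $ j" "0 < u $ i" "0 < v $ j" "0 < K $ i $ j"
  using a b K sol by (auto simp: pos_vec_def pos_matrix_def sinkhorn_solution_def)

lemma row_sum: "(\<Sum>j\<in>UNIV. u $ i * K $ i $ j * v $ j) = a $ i"
  using sol by (auto simp: sinkhorn_solution_def vec_eq_iff matrix_vector_mult_def
      sum_distrib_left mult.assoc)

lemma col_sum: "(\<Sum>i\<in>UNIV. u $ i * K $ i $ j * v $ j) = b $ j"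
  using sol by (auto simp: sinkhorn_solution_def vec_eq_iff matrix_vector_mult_def transpose_def
      sum_distrib_left mult_ac)

lemma sqrt_vec_unit: "sqrt_vec a \<bullet> sqrt_vec a = 1"
  using a pos(1) by (simp add: sqrt_vec_def inner_vec_def prob_vec_def less_imp_le)

lemma N_sqrt_vec: "N *v sqrt_vec b = sqrt_vec a"
proof -
  have "(N *v sqrt_vec b) $ i = (\<Sum>j\<in>UNIV. u $ i * K $ i $ j * v $ j) / sqrt (a $ i)" for i
    unfolding sum_divide_distrib
    using pos(2) by (auto simp: normalized_matrix_def sqrt_vec_def matrix_vector_mult_def
        less_imp_neq[symmetric]
        intro!: sum.cong)
  then show ?thesis
    using pos(1) by (simp add: vec_eq_iff row_sum sqrt_vec_def real_div_sqrt less_imp_le)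
qed

lemma N_contraction: "(N *v y) \<bullet> (N *v y) \<le> y \<bullet> y"
proof -
  \<comment> \<open>AM-GM bounds \<open>x \<bullet> (N *v y)\<close> by \<open>(x \<bullet> x + y \<bullet> y) / 2\<close>.\<close>
  define x where "x = N *v y"
  define P where "P i j = u $ i * K $ i $ j * v $ j" for i j
  have P: "0 \<le> P i j" for i j
    using pos by (simp add: P_def less_imp_le)
  have "x \<bullet> (N *v y) = (\<Sum>i\<in>UNIV. \<Sum>j\<in>UNIV. P i j * ((x $ i / sqrt (a $ i)) * (y $ j / sqrt (b $ j))))"
    by (simp add: inner_vec_def matrix_vector_mult_def normalized_matrix_def P_def sum_distrib_left
        mult_ac)
  also have "\<dots> \<le> (\<Sum>i\<in>UNIV. \<Sum>j\<in>UNIV. P i j * (((x $ i)\<^sup>2 / a $ i + (y $ j)\<^sup>2 / b $ j) / 2))"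
  proof (intro sum_mono mult_left_mono P)
    fix i j
    have "2 * ((x $ i / sqrt (a $ i)) * (y $ j / sqrt (b $ j)))
        \<le> (x $ i / sqrt (a $ i))\<^sup>2 + (y $ j / sqrt (b $ j))\<^sup>2"
      using sum_squares_bound[of "x $ i / sqrt (a $ i)" "y $ j / sqrt (b $ j)"]
      by (simp only: mult.assoc)
    then show "(x $ i / sqrt (a $ i)) * (y $ j / sqrt (b $ j))
        \<le> ((x $ i)\<^sup>2 / a $ i + (y $ j)\<^sup>2 / b $ j) / 2"
      using pos(1)[of i] pos(2)[of j] by (simp add: power_divide mult_ac)
  qed
  \<comment> \<open>Exchanging the sums produces row and column sums of \<open>P\<close>, which
    cancel \<open>a $ i\<close> and \<open>b $ j\<close>.\<close>
  also have "\<dots> = ((\<Sum>i\<in>UNIV. (\<Sum>j\<in>UNIV. P i j) * ((x $ i)\<^sup>2 / a $ i))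
      + (\<Sum>j\<in>UNIV. (\<Sum>i\<in>UNIV. P i j) * ((y $ j)\<^sup>2 / b $ j))) / 2"
  proof -
    have "(\<Sum>i\<in>UNIV. \<Sum>j\<in>UNIV. P i j * ((X i + Y j) / 2))
        = ((\<Sum>i\<in>UNIV. (\<Sum>j\<in>UNIV. P i j) * X i) + (\<Sum>j\<in>UNIV. (\<Sum>i\<in>UNIV. P i j) * Y j)) / 2"
      for X :: "'m \<Rightarrow> real" and Y :: "'n \<Rightarrow> real"
      unfolding sum_distrib_right sum.swap[of "\<lambda>j i. P i j * Y j"]
      by (simp add: sum_divide_distrib[symmetric] sum.distrib distrib_left)
    then show ?thesis .
  qed
  also have "\<dots> = (x \<bullet> x + y \<bullet> y) / 2"
    using pos(1,2) by (simp add: P_def row_sum col_sum inner_vec_def power2_eq_square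
        less_imp_neq[symmetric])
  finally show ?thesis by (simp add: x_def)
qed

text \<open>Conjugation by \<open>diag e\<close>, with \<open>e\<close> the reciprocal of
  \<open>sqrt_vec a\<close>, turns the nonsymmetric M into N N^T. Below, \<open>T\<close> is an
  entry of P diag(1/b) P^T, where P is the scaled matrix.\<close>

lemma eigenvalues_sinkhorn_M: "eigenvalues (sinkhorn_M K a b u v) = eigenvalues (N ** transpose N)"
proof -
  define e :: "real ^ 'm" where "e = (\<chi> i. 1 / sqrt (a $ i))"
  have "(sinkhorn_M K a b u v ** diag e) $ i $ k = (diag e ** (N ** transpose N)) $ i $ k" for i k
  proof -
    define T where
      "T = (\<Sum>j\<in>UNIV. (u $ i * K $ i $ j * v $ j) * (u $ k * K $ k $ j * v $ j) / b $ j)"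
    have M: "sinkhorn_M K a b u v $ i $ k = T / a $ i"
      by (simp add: sinkhorn_M_def scaled_matrix_def recip_def matrix_matrix_mult_def[of "_ ** diag _"]
          diag_mult_nth mult_diag_nth transpose_def sum_divide_distrib T_def
          mult.commute[of "a $ i" "b $ _"])
    have NN: "(N ** transpose N) $ i $ k = T / (sqrt (a $ i) * sqrt (a $ k))"
      unfolding T_def sum_divide_distrib using pos(1,2)
      by (auto simp: matrix_matrix_mult_def normalized_matrix_def transpose_def less_imp_le
          less_imp_neq[symmetric] divide_simps intro!: sum.cong)
    show ?thesis
      using pos(1)[of i] unfolding diag_mult_nth mult_diag_nth M NN e_def
      by (simp add: less_imp_le field_simps)
  qed
  then have "sinkhorn_M K a b u v ** diag e = diag e ** (N ** transpose N)"
    by (simp add: vec_eq_iff)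
  moreover have "det (diag e) \<noteq> 0"
    using pos(1) by (subst det_diagonal) (auto simp: diag_def e_def less_imp_neq[symmetric])
  ultimately show ?thesis
    unfolding eigenvalues_def by (metis charpoly_eqI)
qed

section \<open>Positivity of the bounds\<close>

definition "kappa = (matrix_infnorm K / sigma_min K)\<^sup>2"

lemma matrix_infnorm_pos: "0 < matrix_infnorm K"
proof -
  obtain i where "0 < K $ i $ undefined" using pos(5) by blast
  also have "K $ i $ undefined \<le> (\<Sum>j\<in>UNIV. K $ i $ j)"
    using pos(5) by (intro member_le_sum) (auto simp: less_imp_le)
  also have "\<dots> \<le> matrix_infnorm K" by (rule row_sum_le_matrix_infnorm)
  finally show ?thesis .
qed

text \<open>Either injectivity suffices, because both deltas must be positive whatever the shape of
  \<open>K\<close>. One case bounds \<open>sigma_min K\<close> by the length of a column, the other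
  by the length of a row.\<close>

lemma vec_min_less_kappa:
  assumes n: "2 \<le> CARD('n)" and inj: "inj ((*v) K) \<or> inj ((*v) (transpose K))"
  shows "vec_min a < kappa"
proof -
  note less = entry_less_matrix_infnorm[OF K n]
  have amin: "0 < vec_min a" using vec_min_mem[of a] pos(1) by metis
  have sigma: "0 < sigma_min K"
    using inj injective_sigma_min(1)[of K] injective_sigma_min(1)[of "transpose K"]
    by (auto simp: sigma_min_transpose)
  have "vec_min a * (sigma_min K)\<^sup>2 < (matrix_infnorm K)\<^sup>2"
    using inj
  proof
    assume "inj ((*v) K)"
    from injective_sigma_min(2)[OF this, of "axis undefined 1"]
    have "(sigma_min K)\<^sup>2 \<le> (\<Sum>i\<in>UNIV. (K $ i $ undefined)\<^sup>2)"
      by (simp add: inner_matrix_vector_axis inner_axis_axis)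
    then have "vec_min a * (sigma_min K)\<^sup>2 \<le> vec_min a * (\<Sum>i\<in>UNIV. (K $ i $ undefined)\<^sup>2)"
      using amin by (intro mult_left_mono) auto
    also have "\<dots> \<le> (\<Sum>i\<in>UNIV. a $ i * (K $ i $ undefined)\<^sup>2)"
      unfolding sum_distrib_left by (intro sum_mono mult_right_mono vec_min_le) simp
    also have "\<dots> < (\<Sum>i\<in>UNIV. a $ i * (matrix_infnorm K)\<^sup>2)"
      using pos(1,5) less
      by (intro sum_strict_mono mult_strict_left_mono power_strict_mono) (auto simp: less_imp_le)
    also have "\<dots> = (matrix_infnorm K)\<^sup>2"
      using a(2) by (simp add: prob_vec_def flip: sum_distrib_right)
    finally show ?thesis .
  next
    assume "inj ((*v) (transpose K))"
    from injective_sigma_min(2)[OF this, of "axis undefined 1"]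
    have *: "(sigma_min K)\<^sup>2 \<le> (\<Sum>j\<in>UNIV. (K $ undefined $ j)\<^sup>2)"
      unfolding inner_matrix_vector_axis inner_axis_axis sigma_min_transpose by (simp add: transpose_def)
    have "vec_min a \<le> a $ undefined" by (rule vec_min_le)
    also have "\<dots> \<le> (\<Sum>i\<in>UNIV. a $ i)"
      using pos(1) by (intro member_le_sum) (auto simp: less_imp_le)
    finally have "vec_min a \<le> 1" using a(2) by (simp add: prob_vec_def)
    then have "vec_min a * (sigma_min K)\<^sup>2 \<le> 1 * (sigma_min K)\<^sup>2"
      by (intro mult_right_mono) auto
    also have "1 * (sigma_min K)\<^sup>2 \<le> (\<Sum>j\<in>UNIV. (K $ undefined $ j)\<^sup>2)" using * by simp
    also have "\<dots> < (\<Sum>j\<in>UNIV. K $ undefined $ j * matrix_infnorm K)"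
      using pos(5) less unfolding power2_eq_square
      by (intro sum_strict_mono mult_strict_left_mono) auto
    also have "\<dots> \<le> matrix_infnorm K * matrix_infnorm K"
      unfolding sum_distrib_right[symmetric]
      by (intro mult_right_mono row_sum_le_matrix_infnorm less_imp_le[OF matrix_infnorm_pos])
    finally show ?thesis by (simp add: power2_eq_square)
  qed
  then show ?thesis
    using sigma by (simp add: kappa_def power_divide pos_less_divide_eq)
qed

lemma vec_max_b_less_1: "2 \<le> CARD('n) \<Longrightarrow> vec_max b < 1"
  using vec_max_mem[of b] prob_vec_less_1[OF b] by metis

lemma delta1_pos:
  assumes "2 \<le> CARD('n)" "inj ((*v) K) \<or> inj ((*v) (transpose K))"
  shows "0 < delta1 K a b"
proof -
  have "0 < vec_min a" "0 < vec_max b"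
    using vec_min_mem[of a] vec_max_mem[of b] pos by metis+
  then show ?thesis
    using vec_min_less_kappa[OF assms] vec_max_b_less_1[OF assms(1)]
    by (simp add: delta1_def kappa_def)
qed

lemma component_le_inner_N:
  assumes inj: "inj ((*v) K)" and j: "vec_max v = v $ j"
  shows "vec_min a / kappa * ((z $ j)\<^sup>2 / b $ j) \<le> (N *v z) \<bullet> (N *v z)"
proof -
  \<comment> \<open>Absorbing the column scaling into \<open>y\<close> leaves N z = diag(u / sqrt a)
    K y.\<close>
  define y where "y = (\<chi> j. v $ j * (z $ j / sqrt (b $ j)))"
  let ?L = "matrix_infnorm K"
  have sigma: "0 < sigma_min K" by (rule injective_sigma_min(1)[OF inj])
  have L: "0 < ?L * v $ j" using matrix_infnorm_pos pos(4) by simp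
  have amin: "0 < vec_min a" using vec_min_mem[of a] pos(1) by metis
  have comp: "vec_min a / (?L * v $ j)\<^sup>2 * ((K *v y) $ i)\<^sup>2 \<le> ((N *v z) $ i)\<^sup>2" for i
  proof -
    have Nz: "(N *v z) $ i = u $ i / sqrt (a $ i) * (K *v y) $ i"
      by (simp add: y_def normalized_matrix_def matrix_vector_mult_def sum_distrib_left mult_ac)
    have "(\<Sum>k\<in>UNIV. K $ i $ k * v $ k) \<le> (\<Sum>k\<in>UNIV. K $ i $ k * v $ j)"
      using pos(5) j[symmetric] vec_max_ge[of v]
      by (intro sum_mono mult_left_mono) (auto simp: less_imp_le)
    also have "\<dots> \<le> ?L * v $ j"
      unfolding sum_distrib_right[symmetric]
      by (intro mult_right_mono row_sum_le_matrix_infnorm less_imp_le[OF pos(4)])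
    finally have "u $ i * (\<Sum>k\<in>UNIV. K $ i $ k * v $ k) \<le> u $ i * (?L * v $ j)"
      using pos(3) by (intro mult_left_mono) (auto simp: less_imp_le)
    then have "a $ i \<le> u $ i * (?L * v $ j)"
      by (simp add: sum_distrib_left row_sum flip: mult.assoc)
    then have "(a $ i)\<^sup>2 \<le> (u $ i * (?L * v $ j))\<^sup>2"
      using pos(1) by (intro power_mono) (auto simp: less_imp_le)
    then have "a $ i * a $ i \<le> (u $ i)\<^sup>2 * (?L * v $ j)\<^sup>2"
      by (simp only: power_mult_distrib[of "u $ i"] power2_eq_square[of "a $ i"])
    then have "a $ i / (?L * v $ j)\<^sup>2 \<le> (u $ i)\<^sup>2 / a $ i"
      using pos(1)[of i] L by (subst divide_le_eq) (auto simp: pos_le_divide_eq)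
    moreover have "vec_min a / (?L * v $ j)\<^sup>2 \<le> a $ i / (?L * v $ j)\<^sup>2"
      by (intro divide_right_mono vec_min_le) simp
    ultimately have "vec_min a / (?L * v $ j)\<^sup>2 * ((K *v y) $ i)\<^sup>2
        \<le> (u $ i)\<^sup>2 / a $ i * ((K *v y) $ i)\<^sup>2"
      by (intro mult_right_mono) auto
    also have "\<dots> = ((N *v z) $ i)\<^sup>2"
      unfolding Nz using pos(1)[of i] by (simp add: power_mult_distrib power_divide)
    finally show ?thesis .
  qed
  have "(y $ j)\<^sup>2 \<le> y \<bullet> y"
    unfolding inner_vec_def inner_real_def power2_eq_square[symmetric]
    by (intro member_le_sum) auto
  then have "(sigma_min K)\<^sup>2 * (y $ j)\<^sup>2 \<le> (K *v y) \<bullet> (K *v y)"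
    using injective_sigma_min(2)[OF inj, of y] by (meson mult_left_mono order_trans zero_le_power2)
  then have "vec_min a / (?L * v $ j)\<^sup>2 * ((sigma_min K)\<^sup>2 * (y $ j)\<^sup>2)
      \<le> vec_min a / (?L * v $ j)\<^sup>2 * ((K *v y) \<bullet> (K *v y))"
    using amin by (intro mult_left_mono) auto
  also have "\<dots> \<le> (N *v z) \<bullet> (N *v z)"
    unfolding inner_vec_def inner_real_def power2_eq_square[symmetric] sum_distrib_left
    by (intro sum_mono comp)
  \<comment> \<open>The factor \<open>v $ j\<close> of \<open>y $ j\<close> cancels the one from the
    lower bound on \<open>u\<close>; hence the choice of \<open>j\<close> as the index of the
    largest entry.\<close>
  also have "vec_min a / (?L * v $ j)\<^sup>2 * ((sigma_min K)\<^sup>2 * (y $ j)\<^sup>2)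
      = vec_min a / kappa * ((z $ j)\<^sup>2 / b $ j)"
    using pos(2,4)[of j] sigma matrix_infnorm_pos
    by (simp add: y_def kappa_def power_mult_distrib power_divide)
  finally show ?thesis .
qed

lemma delta1_test_vector:
  assumes n: "2 \<le> CARD('n)" and inj: "inj ((*v) K)"
  obtains x where "x \<noteq> 0" "x \<bullet> sqrt_vec b = 0" "delta1 K a b * (x \<bullet> x) \<le> (N *v x) \<bullet> (N *v x)"
proof -
  interpret dual: sinkhorn_scaling "transpose K" b v a u by (rule dual)
  obtain j where j: "vec_max v = v $ j" using vec_max_mem by blast
  define q where "q = sqrt_vec b"
  \<comment> \<open>As \<open>q $ j = sqrt (b $ j)\<close>, this is a multiple of the projection of
    the unit vector. The scaling gives \<open>z $ j\<close> the factor \<open>sqrt (b $ j)\<close>,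
    which cancels the division by \<open>b $ j\<close> in the component bound.\<close>
  define x where "x = sqrt (b $ j) *\<^sub>R axis j 1 - b $ j *\<^sub>R q"
  define \<alpha> where "\<alpha> = vec_min a / kappa"
  define s where "s = 1 - b $ j"
  define c where "c = \<alpha> * s / (1 - \<alpha>)" \<comment> \<open>maximises \<open>\<alpha> (s + c)\<^sup>2 - c\<^sup>2\<close>\<close>
  have b0: "0 < b $ j" by (rule pos)
  have s0: "0 < s" using prob_vec_less_1[OF b n, of j] by (simp add: s_def)
  have amin: "0 < vec_min a" using vec_min_mem[of a] pos(1) by metis
  have kappa: "vec_min a < kappa" using vec_min_less_kappa[OF n] inj by blast
  then have \<alpha>: "0 < \<alpha>" "\<alpha> < 1" using amin by (simp_all add: \<alpha>_def)
  have qq: "q \<bullet> q = 1" unfolding q_def by (rule dual.sqrt_vec_unit)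
  have qj: "axis j 1 \<bullet> q = sqrt (b $ j)" "q \<bullet> axis j 1 = sqrt (b $ j)"
    by (simp_all add: q_def sqrt_vec_def inner_axis inner_axis')
  have xq: "x \<bullet> q = 0"
    using b0 by (simp add: x_def inner_diff_left qq qj)
  have xx: "x \<bullet> x = b $ j * s"
    using b0 by (simp add: x_def inner_diff_left inner_diff_right qq qj inner_axis_axis s_def
        algebra_simps)
  then have x0: "x \<noteq> 0" using b0 s0 by auto
  have NTq: "transpose N *v sqrt_vec a = q"
    unfolding q_def transpose_normalized_matrix by (rule dual.N_sqrt_vec)
  have Nxp: "(N *v x) \<bullet> sqrt_vec a = 0"
    using xq by (simp only: inner_transpose_mult[symmetric] NTq)
  define z where "z = x + c *\<^sub>R q"
  have "N *v z = N *v x + c *\<^sub>R sqrt_vec a"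
    by (simp add: z_def matrix_vector_right_distrib matrix_vector_mult_scaleR q_def N_sqrt_vec)
  then have Nz: "(N *v z) \<bullet> (N *v z) = (N *v x) \<bullet> (N *v x) + c\<^sup>2"
    using Nxp inner_commute[of "sqrt_vec a" "N *v x"]
    by (simp add: inner_left_distrib inner_right_distrib sqrt_vec_unit power2_eq_square)
  have "z $ j = sqrt (b $ j) * (s + c)"
    by (simp add: z_def x_def q_def sqrt_vec_def axis_def s_def algebra_simps)
  then have "\<alpha> * (s + c)\<^sup>2 \<le> (N *v x) \<bullet> (N *v x) + c\<^sup>2"
    using component_le_inner_N[OF inj j, of z] b0 by (simp add: Nz \<alpha>_def power_mult_distrib)
  moreover have "\<alpha> * (s + c)\<^sup>2 - c\<^sup>2 = \<alpha> * s\<^sup>2 / (1 - \<alpha>)"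
  proof -
    have "s + c = s / (1 - \<alpha>)" using \<alpha> by (simp add: c_def field_simps)
    then have "\<alpha> * (s + c)\<^sup>2 - c\<^sup>2 = \<alpha> * s\<^sup>2 * (1 - \<alpha>) / (1 - \<alpha>)\<^sup>2"
      by (simp add: c_def power_divide power_mult_distrib power2_eq_square[of \<alpha>]
          diff_divide_distrib[symmetric] algebra_simps)
    then show ?thesis using \<alpha> by (simp add: power2_eq_square)
  qed
  ultimately have "\<alpha> * s\<^sup>2 / (1 - \<alpha>) \<le> (N *v x) \<bullet> (N *v x)" by linarith
  also have "\<alpha> * s\<^sup>2 / (1 - \<alpha>) = vec_min a * s\<^sup>2 / (kappa - vec_min a)"
    using amin kappa by (simp add: \<alpha>_def field_simps)
  finally have main: "vec_min a * s\<^sup>2 / (kappa - vec_min a) \<le> (N *v x) \<bullet> (N *v x)" .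
  have bj: "b $ j \<le> vec_max b" by (rule vec_max_ge)
  \<comment> \<open>Since (1 - t) / t decreases in t, the uncontrolled \<open>b $ j\<close> can be
    replaced by \<open>vec_max b\<close>.\<close>
  have "(1 - vec_max b) / vec_max b * b $ j \<le> s"
    using bj b0 by (simp add: s_def field_simps)
  then have "vec_min a / (kappa - vec_min a) * s * ((1 - vec_max b) / vec_max b * b $ j)
      \<le> vec_min a / (kappa - vec_min a) * s * s"
    using amin kappa s0 by (intro mult_left_mono) auto
  then have "delta1 K a b * (x \<bullet> x) \<le> vec_min a * s\<^sup>2 / (kappa - vec_min a)"
    by (simp add: delta1_def kappa_def xx power2_eq_square[of s] mult_ac)
  with main x0 xq show ?thesis
    using that by (auto simp: q_def)
qed

section \<open>From test vectors to the second eigenvalue\<close>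

lemma Rayleigh_le_1:
  assumes "x \<noteq> 0" "r * (x \<bullet> x) \<le> (N *v x) \<bullet> (N *v x)"
  shows "r \<le> 1"
proof -
  have "r * (x \<bullet> x) \<le> 1 * (x \<bullet> x)"
    using assms(2) N_contraction[of x] by simp
  then show ?thesis using assms(1) by (simp add: mult_le_cancel_right)
qed

lemma second_largest_eigenvalue_sinkhorn_M_ge:
  assumes w: "w \<noteq> 0" "w \<bullet> sqrt_vec a = 0"
    "r * (w \<bullet> w) \<le> (transpose N *v w) \<bullet> (transpose N *v w)"
  shows "r \<le> second_largest_eigenvalue (sinkhorn_M K a b u v)"
proof -
  interpret dual: sinkhorn_scaling "transpose K" b v a u by (rule dual)
  let ?A = "N ** transpose N"
  have sym: "transpose ?A = ?A"
    by (simp add: matrix_transpose_mul)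
  have fixp: "?A *v sqrt_vec a = sqrt_vec a"
    by (metis N_sqrt_vec dual.N_sqrt_vec matrix_vector_mul_assoc transpose_normalized_matrix)
  have "sqrt_vec a \<noteq> 0" using sqrt_vec_unit by auto
  moreover have "w \<bullet> (?A *v w) = (transpose N *v w) \<bullet> (transpose N *v w)"
    by (metis inner_transpose_mult matrix_vector_mul_assoc transpose_transpose)
  moreover have "r \<le> 1"
    using dual.Rayleigh_le_1[OF w(1)] w(3) by (simp add: transpose_normalized_matrix)
  ultimately have "r \<le> second_largest_eigenvalue ?A"
    using w sym fixp by (intro second_largest_eigenvalue_ge_Rayleigh) auto
  then show ?thesis
    by (simp add: second_largest_eigenvalue_def eigenvalues_sinkhorn_M)
qed

text \<open>The dual test vector is already orthogonal to \<open>sqrt_vec a\<close>, so it can be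
  used directly.\<close>

lemma delta1_transpose_le:
  assumes m: "2 \<le> CARD('m)" and inj: "inj ((*v) (transpose K))"
  shows "delta1 (transpose K) b a \<le> second_largest_eigenvalue (sinkhorn_M K a b u v)"
proof -
  interpret dual: sinkhorn_scaling "transpose K" b v a u by (rule dual)
  show ?thesis
    using dual.delta1_test_vector[OF m inj] second_largest_eigenvalue_sinkhorn_M_ge
    by (metis transpose_normalized_matrix)
qed

text \<open>Here the test vector \<open>x\<close> lies on the column side and is carried over to
  \<open>w = N *v x\<close>. By Cauchy-Schwarz |w|^4 \<le> |x|^2 |N^T w|^2, so the Rayleigh quotient
  does not drop; positivity of \<open>delta1\<close> ensures that \<open>w\<close> is
  nonzero.\<close>

lemma delta1_le:
  assumes n: "2 \<le> CARD('n)" and inj: "inj ((*v) K)"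
  shows "delta1 K a b \<le> second_largest_eigenvalue (sinkhorn_M K a b u v)"
proof -
  interpret dual: sinkhorn_scaling "transpose K" b v a u by (rule dual)
  let ?r = "delta1 K a b"
  obtain x where x: "x \<noteq> 0" "x \<bullet> sqrt_vec b = 0" "?r * (x \<bullet> x) \<le> (N *v x) \<bullet> (N *v x)"
    using delta1_test_vector[OF n inj] .
  define w where "w = N *v x"
  have r: "0 < ?r" using delta1_pos n inj by blast
  have xx: "0 < x \<bullet> x" using x(1) by simp
  have ww: "0 < w \<bullet> w"
    using x(3) mult_pos_pos[OF r xx] unfolding w_def by linarith
  have wp: "w \<bullet> sqrt_vec a = 0"
    using x(2) by (metis w_def dual.N_sqrt_vec inner_transpose_mult transpose_normalized_matrix)
  have "w \<bullet> w = x \<bullet> (transpose N *v w)"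
    unfolding inner_transpose_mult w_def ..
  then have "(w \<bullet> w)\<^sup>2 \<le> (x \<bullet> x) * ((transpose N *v w) \<bullet> (transpose N *v w))"
    by (metis Cauchy_Schwarz_ineq)
  moreover have "(?r * (x \<bullet> x)) * (w \<bullet> w) \<le> (w \<bullet> w) * (w \<bullet> w)"
    using x(3) ww by (intro mult_right_mono) (auto simp: w_def)
  ultimately have "(x \<bullet> x) * (?r * (w \<bullet> w))
      \<le> (x \<bullet> x) * ((transpose N *v w) \<bullet> (transpose N *v w))"
    by (simp add: power2_eq_square mult_ac)
  then have "?r * (w \<bullet> w) \<le> (transpose N *v w) \<bullet> (transpose N *v w)"
    using xx by (simp only: mult_le_cancel_left_pos)
  then show ?thesis
    using ww wp by (intro second_largest_eigenvalue_sinkhorn_M_ge[of w]) auto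
qed

end

theorem theorem4:
  fixes K :: "real ^ 'n ^ 'm"
    and a u :: "real ^ 'm"
    and b v :: "real ^ 'n"
  assumes "pos_vec a" and "prob_vec a"
    and "pos_vec b" and "prob_vec b"
    and "pos_matrix K"
    and "rank K = min CARD('m) CARD('n)"
    and "min CARD('m) CARD('n) \<ge> 2"
    and "sinkhorn_solution K a b u v"
  shows "delta1 K a b > 0 \<and> delta2 K a b > 0 \<and>
    second_largest_eigenvalue (sinkhorn_M K a b u v) \<ge> delta K a b"
proof -
  interpret sinkhorn_scaling K a u b v
    using assms by unfold_locales
  interpret dual: sinkhorn_scaling "transpose K" b v a u by (rule dual)
  have card: "2 \<le> CARD('m)" "2 \<le> CARD('n)" using assms(7) by auto
  \<comment> \<open>Full rank makes \<open>K\<close> injective if n \<le> m and K^T injective if m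
    \<le> n. For m = n both bounds hold, hence the maximum.\<close>
  have inj: "CARD('n) \<le> CARD('m) \<Longrightarrow> inj ((*v) K)"
    using assms(6) by (simp add: full_rank_injective[symmetric])
  have inj': "CARD('m) \<le> CARD('n) \<Longrightarrow> inj ((*v) (transpose K))"
    using assms(6) by (simp add: full_rank_injective[symmetric] rank_transpose)
  have inj_or: "inj ((*v) K) \<or> inj ((*v) (transpose K))"
    using inj inj' by linarith
  have delta2: "delta2 K a b = delta1 (transpose K) b a"
    by (simp add: delta1_def delta2_def sigma_min_transpose)
  have "delta K a b \<le> second_largest_eigenvalue (sinkhorn_M K a b u v)"
    using delta1_le[OF card(2)] delta1_transpose_le[OF card(1)] inj inj'
    by (simp add: delta_def delta2)
  then show ?thesis
    using delta1_pos[OF card(2) inj_or] dual.delta1_pos[OF card(1)] inj_or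
    by (auto simp: delta2)
qed

end
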